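(* Let $n\ge 1$, let $G$ be a $GBS_n$ group with given base $\mathbb{Z}^n$-subgroup $A$, and suppose that the monodromy of $G$ is infinite. Then there is a non-trivial element $z\in A$ such that for any isometric action of $G$ on a hyperbolic space, the element $z$ does not act loxodromically.
   Context: Let $n\ge 1$. A generalised rank $n$ Baumslag-Solitar group ($GBS_n$ group) is a group $G$ which is the fundamental group of a finite (connected) graph of groups in which all vertex and edge groups are isomorphic to $\mathbb{Z}^n$; a $GBS_n$ group is understood to come with such a decomposition. $G$ then acts without edge inversions and cocompactly on the Bass-Serre tree $T$ of the decomposition, which is locally finite. Modular homomorphism and monodromy: choose a base vertex $v_0$ of $T$, a finite index subgroup $A\cong\mathbb{Z}^n$ of $\mathrm{Stab}_G(v_0)\cong\mathbb{Z}^n$ (called a base $\mathbb{Z}^n$-subgroup of $G$) and an ordered basis $a_1,\ldots,a_n$ of $A$. For any $g\in G$ the subgroups $A$ and $g^{-1}Ag$ are commensurable, so there is $m>0$ such that $\langle a_1^m,\ldots,a_n^m\rangle$ is a finite index subgroup of $A\cap g^{-1}Ag$. Hence there are unique integers $g_{ij}$ with $g a_j^m g^{-1}=a_1^{g_{1j}}\cdots a_n^{g_{nj}}$ for each $j$. The modular homomorphism $\mathcal{M}:G\to GL(n,\mathbb{Q})$ sends $g$ to the matrix with $(i,j)$ entry $g_{ij}/m$. This is independent of $m$, is a homomorphism, and changing the choices of $v_0$, $A$ and basis changes $\mathcal{M}$ only by conjugation in $GL(n,\mathbb{Q})$. The monodromy of $G$ is the image $\mathcal{M}(G)$; it is infinite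 if this group has infinite order. A hyperbolic space is a geodesic metric space which is $\delta$-hyperbolic (in the sense of Gromov) for some $\delta\ge 0$; it need not be proper. An element $g$ of a group acting by isometries on a hyperbolic space $X$ acts loxodromically if there are $x\in X$ and $c>0$ with $d(g^k(x),x)\ge |k|c$ for all $k\in\mathbb{Z}$ (equivalently, $k\mapsto g^k(x)$ is a quasi-isometric embedding of $\mathbb{Z}$ into $X$). *)

theory Defs
  imports
    "HOL-Analysis.Analysis"
    "HOL-Algebra.FiniteProduct"
    "HOL-Algebra.Product_Groups"
    "HOL-Algebra.Elementary_Groups"
    "HOL-Algebra.Group_Action"
    "HOL-Algebra.Left_Coset"
begin

section \<open>Graphs of groups and their fundamental groups\<close>

text \<open>
  Conventions follow Serre's \<open>Trees\<close>: edges are oriented, \<open>erev\<close> is the fixed-point-free reversal,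
  an edge and its reverse carry the same edge group, and \<open>emb e\<close> embeds the edge group of \<open>e\<close> into
  the vertex group at the terminal vertex \<open>tgt e\<close>.
\<close>

record ('v, 'e, 'a, 'b) graph_of_groups =
  verts :: "'v set"
  edges :: "'e set"
  src :: "'e \<Rightarrow> 'v"
  tgt :: "'e \<Rightarrow> 'v"
  erev :: "'e \<Rightarrow> 'e"
  vgrp :: "'v \<Rightarrow> 'a monoid"
  egrp :: "'e \<Rightarrow> 'b monoid"
  emb :: "'e \<Rightarrow> 'b \<Rightarrow> 'a"

fun edge_path ::
  "('v, 'e, 'a, 'b) graph_of_groups \<Rightarrow> 'e set \<Rightarrow> 'v \<Rightarrow> 'e list \<Rightarrow> 'v \<Rightarrow> bool" where
  "edge_path Y F u [] v \<longleftrightarrow> u \<in> verts Y \<and> u = v"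
| "edge_path Y F u (e # p) v \<longleftrightarrow>
     u \<in> verts Y \<and> e \<in> F \<and> src Y e = u \<and> edge_path Y F (tgt Y e) p v"

definition reduced_path :: "('v, 'e, 'a, 'b) graph_of_groups \<Rightarrow> 'e list \<Rightarrow> bool" where
  "reduced_path Y p \<longleftrightarrow> successively (\<lambda>e f. f \<noteq> erev Y e) p"

definition connected_graph_of_groups :: "('v, 'e, 'a, 'b) graph_of_groups \<Rightarrow> bool" where
  "connected_graph_of_groups Y \<longleftrightarrow>
     verts Y \<noteq> {} \<and>
     (\<forall>e\<in>edges Y. src Y e \<in> verts Y \<and> tgt Y e \<in> verts Y \<and>
        erev Y e \<in> edges Y \<and> erev Y e \<noteq> e \<and> erev Y (erev Y e) = e \<and>
        src Y (erev Y e) = tgt Y e \<and> tgt Y (erev Y e) = src Y e) \<and>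
     (\<forall>u\<in>verts Y. \<forall>v\<in>verts Y. \<exists>p. edge_path Y (edges Y) u p v) \<and>
     (\<forall>v\<in>verts Y. group (vgrp Y v)) \<and>
     (\<forall>e\<in>edges Y. group (egrp Y e) \<and> egrp Y (erev Y e) = egrp Y e \<and>
        emb Y e \<in> hom (egrp Y e) (vgrp Y (tgt Y e)) \<and> inj_on (emb Y e) (carrier (egrp Y e)))"

text \<open>The uniqueness for \<open>u = v\<close> excludes non-trivial closed reduced paths.\<close>

definition spanning_tree :: "('v, 'e, 'a, 'b) graph_of_groups \<Rightarrow> 'e set \<Rightarrow> bool" where
  "spanning_tree Y T \<longleftrightarrow>
     T \<subseteq> edges Y \<and> erev Y ` T \<subseteq> T \<and>
     (\<forall>u\<in>verts Y. \<forall>v\<in>verts Y. \<exists>!p. edge_path Y T u p v \<and> reduced_path Y p)"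

datatype ('v, 'e, 'a) letter = Vtx 'v 'a | Edg 'e

definition gog_words :: "('v, 'e, 'a, 'b) graph_of_groups \<Rightarrow> ('v, 'e, 'a) letter list set" where
  "gog_words Y =
     lists ({Vtx v a | v a. v \<in> verts Y \<and> a \<in> carrier (vgrp Y v)} \<union> Edg ` edges Y)"

text \<open>
  The defining relations of the fundamental group of \<open>Y\<close> with respect to the spanning tree \<open>T\<close>:
  the multiplication of each vertex group, \<open>e\<inverse> = erev e\<close>, \<open>e (emb e c) e\<inverse> = emb (erev e) c\<close>
  for \<open>c\<close> in the edge group of \<open>e\<close>, and \<open>e = 1\<close> for \<open>e\<close> in \<open>T\<close>.
\<close>

inductive gog_rel ::
  "('v, 'e, 'a, 'b) graph_of_groups \<Rightarrow> 'e set \<Rightarrow>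
     ('v, 'e, 'a) letter list \<Rightarrow> ('v, 'e, 'a) letter list \<Rightarrow> bool"
  for Y T where
  vtx_mult: "\<lbrakk>v \<in> verts Y; a \<in> carrier (vgrp Y v); b \<in> carrier (vgrp Y v)\<rbrakk> \<Longrightarrow>
     gog_rel Y T [Vtx v a, Vtx v b] [Vtx v (a \<otimes>\<^bsub>vgrp Y v\<^esub> b)]"
| vtx_one: "v \<in> verts Y \<Longrightarrow> gog_rel Y T [Vtx v \<one>\<^bsub>vgrp Y v\<^esub>] []"
| edge_inv: "e \<in> edges Y \<Longrightarrow> gog_rel Y T [Edg e, Edg (erev Y e)] []"
| edge_conj: "\<lbrakk>e \<in> edges Y; c \<in> carrier (egrp Y e)\<rbrakk> \<Longrightarrow>
     gog_rel Y T [Edg e, Vtx (tgt Y e) (emb Y e c), Edg (erev Y e)]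
                 [Vtx (src Y e) (emb Y (erev Y e) c)]"
| tree_edge: "e \<in> T \<Longrightarrow> gog_rel Y T [Edg e] []"

definition gog_cong ::
  "('v, 'e, 'a, 'b) graph_of_groups \<Rightarrow> 'e set \<Rightarrow>
     ('v, 'e, 'a) letter list \<Rightarrow> ('v, 'e, 'a) letter list \<Rightarrow> bool" where
  "gog_cong Y T =
     equivclp (\<lambda>x y. \<exists>u w l r. gog_rel Y T l r \<and> x = u @ l @ w \<and> y = u @ r @ w)"

definition gog_class ::
  "('v, 'e, 'a, 'b) graph_of_groups \<Rightarrow> 'e set \<Rightarrow>
     ('v, 'e, 'a) letter list \<Rightarrow> ('v, 'e, 'a) letter list set" where
  "gog_class Y T x = {y \<in> gog_words Y. gog_cong Y T x y}"

definition fundamental_group ::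
  "('v, 'e, 'a, 'b) graph_of_groups \<Rightarrow> 'e set \<Rightarrow> ('v, 'e, 'a) letter list set monoid" where
  "fundamental_group Y T =
     \<lparr>carrier = gog_class Y T ` gog_words Y,
      monoid.mult = (\<lambda>C D. \<Union>x\<in>C. \<Union>y\<in>D. gog_class Y T (x @ y)),
      one = gog_class Y T []\<rparr>"

section \<open>Generalised Baumslag-Solitar groups\<close>

text \<open>
  The rank \<open>n\<close> is \<open>CARD('n)\<close> for a finite (hence non-empty) index type \<open>'n\<close>.
\<close>

definition Zn :: "'n::finite itself \<Rightarrow> ('n \<Rightarrow> int) monoid" where
  "Zn _ = product_group (UNIV :: 'n set) (\<lambda>_. integer_group)"

text \<open>
  \<open>GBS TYPE('n) G Y T \<phi>\<close>: the group \<open>G\<close> is identified via \<open>\<phi>\<close> with the fundamental group of the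
  finite graph of groups \<open>Y\<close>, all of whose vertex and edge groups are isomorphic to \<open>\<int>\<^sup>n\<close>.
\<close>

definition GBS ::
  "'n::finite itself \<Rightarrow> 'g monoid \<Rightarrow> ('v, 'e, 'a, 'b) graph_of_groups \<Rightarrow> 'e set \<Rightarrow>
     (('v, 'e, 'a) letter list set \<Rightarrow> 'g) \<Rightarrow> bool" where
  "GBS N G Y T \<phi> \<longleftrightarrow>
     group G \<and> connected_graph_of_groups Y \<and> finite (verts Y) \<and> finite (edges Y) \<and>
     (\<forall>v\<in>verts Y. vgrp Y v \<cong> Zn N) \<and> (\<forall>e\<in>edges Y. egrp Y e \<cong> Zn N) \<and>
     spanning_tree Y T \<and> \<phi> \<in> iso (fundamental_group Y T) G"

definition vertex_subgroup ::
  "('v, 'e, 'a, 'b) graph_of_groups \<Rightarrow> 'e set \<Rightarrow>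
     (('v, 'e, 'a) letter list set \<Rightarrow> 'g) \<Rightarrow> 'v \<Rightarrow> 'g set" where
  "vertex_subgroup Y T \<phi> v = (\<lambda>a. \<phi> (gog_class Y T [Vtx v a])) ` carrier (vgrp Y v)"

text \<open>
  The vertices of the Bass-Serre tree are the left cosets of the vertex subgroups (tagged with the
  vertex of \<open>Y\<close> they lie over), on which \<open>G\<close> acts by left multiplication.
\<close>

definition bass_serre_verts ::
  "'g monoid \<Rightarrow> ('v, 'e, 'a, 'b) graph_of_groups \<Rightarrow> 'e set \<Rightarrow>
     (('v, 'e, 'a) letter list set \<Rightarrow> 'g) \<Rightarrow> ('v \<times> 'g set) set" where
  "bass_serre_verts G Y T \<phi> = (SIGMA v:verts Y. lcosets\<^bsub>G\<^esub> (vertex_subgroup Y T \<phi> v))"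

definition bass_serre_action :: "'g monoid \<Rightarrow> 'g \<Rightarrow> 'v \<times> 'g set \<Rightarrow> 'v \<times> 'g set" where
  "bass_serre_action G g x = (fst x, g <#\<^bsub>G\<^esub> snd x)"

definition finite_index_in :: "'g monoid \<Rightarrow> 'g set \<Rightarrow> 'g set \<Rightarrow> bool" where
  "finite_index_in G H K \<longleftrightarrow>
     subgroup H G \<and> subgroup K G \<and> H \<subseteq> K \<and> finite (rcosets\<^bsub>G\<lparr>carrier := K\<rparr>\<^esub> H)"

definition base_Zn_subgroup ::
  "'n::finite itself \<Rightarrow> 'g monoid \<Rightarrow> ('v, 'e, 'a, 'b) graph_of_groups \<Rightarrow> 'e set \<Rightarrow>
     (('v, 'e, 'a) letter list set \<Rightarrow> 'g) \<Rightarrow> 'g set \<Rightarrow> bool" where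
  "base_Zn_subgroup N G Y T \<phi> A \<longleftrightarrow>
     (\<exists>v0\<in>bass_serre_verts G Y T \<phi>.
        finite_index_in G A (stabilizer G (bass_serre_action G) v0)) \<and>
     G\<lparr>carrier := A\<rparr> \<cong> Zn N"

section \<open>The modular homomorphism\<close>

text \<open>
  The product of the powers of a family in the abelian subgroup \<open>A\<close> is formed in
  \<open>G\<lparr>carrier := A\<rparr>\<close>, since \<open>finprod\<close> requires a commutative monoid.
\<close>

definition power_product ::
  "'g monoid \<Rightarrow> 'g set \<Rightarrow> ('n::finite \<Rightarrow> 'g) \<Rightarrow> ('n \<Rightarrow> int) \<Rightarrow> 'g" where
  "power_product G A a k = finprod (G\<lparr>carrier := A\<rparr>) (\<lambda>i. a i [^]\<^bsub>G\<^esub> k i) UNIV"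

definition Z_basis :: "'g monoid \<Rightarrow> 'g set \<Rightarrow> ('n::finite \<Rightarrow> 'g) \<Rightarrow> bool" where
  "Z_basis G A a \<longleftrightarrow> range a \<subseteq> A \<and> (\<forall>x\<in>A. \<exists>!k. x = power_product G A a k)"

definition modular_matrix ::
  "'g monoid \<Rightarrow> 'g set \<Rightarrow> ('n::finite \<Rightarrow> 'g) \<Rightarrow> 'g \<Rightarrow> rat^'n^'n \<Rightarrow> bool" where
  "modular_matrix G A a g M \<longleftrightarrow>
     (\<exists>(m::nat) (k :: 'n \<Rightarrow> 'n \<Rightarrow> int).
        m > 0 \<and>
        finite_index_in G (generate G (range (\<lambda>j. a j [^]\<^bsub>G\<^esub> m)))
          (A \<inter> (\<lambda>x. inv\<^bsub>G\<^esub> g \<otimes>\<^bsub>G\<^esub> x \<otimes>\<^bsub>G\<^esub> g) ` A) \<and>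
        (\<forall>j. g \<otimes>\<^bsub>G\<^esub> (a j [^]\<^bsub>G\<^esub> m) \<otimes>\<^bsub>G\<^esub> inv\<^bsub>G\<^esub> g = power_product G A a (\<lambda>i. k i j)) \<and>
        M = (\<chi> i j. of_int (k i j) / of_nat m))"

definition modular_hom ::
  "'g monoid \<Rightarrow> 'g set \<Rightarrow> ('n::finite \<Rightarrow> 'g) \<Rightarrow> 'g \<Rightarrow> rat^'n^'n" where
  "modular_hom G A a g = (THE M. modular_matrix G A a g M)"

definition monodromy ::
  "'g monoid \<Rightarrow> 'g set \<Rightarrow> ('n::finite \<Rightarrow> 'g) \<Rightarrow> (rat^'n^'n) set" where
  "monodromy G A a = modular_hom G A a ` carrier G"

section \<open>Isometric actions on hyperbolic spaces\<close>

definition geodesic_space :: "'x set \<Rightarrow> ('x \<Rightarrow> 'x \<Rightarrow> real) \<Rightarrow> bool" where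
  "geodesic_space X d \<longleftrightarrow>
     Metric_space X d \<and>
     (\<forall>x\<in>X. \<forall>y\<in>X. \<exists>\<gamma>::real \<Rightarrow> 'x.
        \<gamma> ` {0..d x y} \<subseteq> X \<and> \<gamma> 0 = x \<and> \<gamma> (d x y) = y \<and>
        (\<forall>s\<in>{0..d x y}. \<forall>t\<in>{0..d x y}. d (\<gamma> s) (\<gamma> t) = \<bar>s - t\<bar>))"

definition gromov_product :: "('x \<Rightarrow> 'x \<Rightarrow> real) \<Rightarrow> 'x \<Rightarrow> 'x \<Rightarrow> 'x \<Rightarrow> real" where
  "gromov_product d w x y = (d x w + d y w - d x y) / 2"

definition hyperbolic_space :: "'x set \<Rightarrow> ('x \<Rightarrow> 'x \<Rightarrow> real) \<Rightarrow> bool" where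
  "hyperbolic_space X d \<longleftrightarrow>
     geodesic_space X d \<and>
     (\<exists>\<delta>\<ge>0. \<forall>w\<in>X. \<forall>x\<in>X. \<forall>y\<in>X. \<forall>z\<in>X.
        gromov_product d w x z \<ge> min (gromov_product d w x y) (gromov_product d w y z) - \<delta>)"

definition isometric_action ::
  "'g monoid \<Rightarrow> 'x set \<Rightarrow> ('x \<Rightarrow> 'x \<Rightarrow> real) \<Rightarrow> ('g \<Rightarrow> 'x \<Rightarrow> 'x) \<Rightarrow> bool" where
  "isometric_action G X d \<rho> \<longleftrightarrow>
     group_action G X \<rho> \<and>
     (\<forall>g\<in>carrier G. \<forall>x\<in>X. \<forall>y\<in>X. d (\<rho> g x) (\<rho> g y) = d x y)"

definition acts_loxodromically ::
  "'g monoid \<Rightarrow> 'x set \<Rightarrow> ('x \<Rightarrow> 'x \<Rightarrow> real) \<Rightarrow> ('g \<Rightarrow> 'x \<Rightarrow> 'x) \<Rightarrow> 'g \<Rightarrow> bool" where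
  "acts_loxodromically G X d \<rho> g \<longleftrightarrow>
     (\<exists>x\<in>X. \<exists>c>0. \<forall>k::int. d (\<rho> (g [^]\<^bsub>G\<^esub> k) x) x \<ge> of_int \<bar>k\<bar> * c)"

text \<open>
  A formula cannot quantify over types, so ``any hyperbolic space'' is split by the type \<open>'x\<close> of
  points. A statement of the form \<open>\<exists>z. never_loxodromic TYPE('x) G z\<close> would let \<open>z\<close> depend on \<open>'x\<close>.
  To obtain a single \<open>z\<close> for all spaces, one asserts that some \<open>z\<close> satisfies
  \<open>never_loxodromic TYPE(real) G z\<close> and, for arbitrary \<open>'x\<close>, that every such \<open>z\<close> satisfies
  \<open>never_loxodromic TYPE('x) G z\<close>. The metrics are arbitrary, so \<open>real\<close> only bounds the cardinality
  of the spaces by that of the continuum.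
\<close>

definition never_loxodromic :: "'x itself \<Rightarrow> 'g monoid \<Rightarrow> 'g \<Rightarrow> bool" where
  "never_loxodromic _ G z \<longleftrightarrow>
     (\<forall>(X :: 'x set) d \<rho>.
        hyperbolic_space X d \<longrightarrow> isometric_action G X d \<rho> \<longrightarrow> \<not> acts_loxodromically G X d \<rho> z)"

end

theory Submission
  imports Defs
begin

text \<open>
  Suppose that \<open>A\<close> acts on a hyperbolic space with a loxodromic element. The stable translation length
  \<open>\<tau>\<close> is subadditive on \<open>A\<close>, and the four-point condition at \<open>x, g x, h x, g h x\<close> forces
  \<open>\<tau> = \<bar>\<beta>\<bar>\<close> for a homomorphism \<open>\<beta> : A \<rightarrow> \<real>\<close>. Since \<open>\<tau>\<close> is invariant under conjugation,
  \<open>\<beta> \<circ> M = \<plusminus> \<beta>\<close> for every \<open>M\<close> in the monodromy. If such \<open>\<beta>\<close> separated the points of \<open>A\<close>, then finitely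
  many of them would, and the monodromy would be finite, as \<open>M\<close> would be determined by finitely many
  signs. So they have a common kernel element \<open>z \<noteq> 1\<close>, which is never loxodromic.

  Points of type \<open>real\<close> suffice by a Loewenheim-Skolem argument: \<open>G\<close> is countable, so a point lies in
  a \<open>G\<close>-invariant geodesic subspace of cardinality at most that of the continuum.
\<close>

section \<open>Stable lengths and additivity on abelian subgroups\<close>

lemma (in group) conj_mult:
  assumes "g \<in> carrier G" "x \<in> carrier G" "y \<in> carrier G"
  shows "(g \<otimes> x \<otimes> inv g) \<otimes> (g \<otimes> y \<otimes> inv g) = g \<otimes> (x \<otimes> y) \<otimes> inv g"
proof -
  have "(g \<otimes> x \<otimes> inv g) \<otimes> (g \<otimes> y \<otimes> inv g) = g \<otimes> x \<otimes> (inv g \<otimes> g) \<otimes> y \<otimes> inv g"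
    using assms by (simp only: m_assoc m_closed inv_closed)
  then show ?thesis
    using assms by (simp add: m_assoc)
qed

lemma (in group) conj_nat_pow:
  assumes "g \<in> carrier G" "x \<in> carrier G"
  shows "(g \<otimes> x \<otimes> inv g) [^] (n::nat) = g \<otimes> x [^] n \<otimes> inv g"
  using assms by (induction n) (simp_all add: conj_mult)

text \<open>Jordan-von Neumann polarisation: up to a factor, \<open>F\<close> is the bilinear form
  of \<open>q\<close> paired with \<open>z\<close>. Subtracting the laws at
  \<open>u \<otimes> z\<close>, \<open>v\<close> and at \<open>u \<otimes> inv z\<close>,
  \<open>v\<close> gives Jensen's equation, which oddness of \<open>F\<close> turns into
  additivity.\<close>

lemma (in comm_group) parallelogram_imp_additive:
  fixes q :: "'a \<Rightarrow> real"
  assumes q: "\<And>x y. x \<in> carrier G \<Longrightarrow> y \<in> carrier G \<Longrightarrow>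
      q (x \<otimes> y) + q (x \<otimes> inv y) = 2 * q x + 2 * q y"
    and z: "z \<in> carrier G"
    and F: "F = (\<lambda>x. q (x \<otimes> z) - q (x \<otimes> inv z))"
    and x: "x \<in> carrier G" and y: "y \<in> carrier G"
  shows "F (x \<otimes> y) = F x + F y"
proof -
  have jensen: "F (u \<otimes> v) + F (u \<otimes> inv v) = 2 * F u"
    if u: "u \<in> carrier G" and v: "v \<in> carrier G" for u v
  proof -
    have "u \<otimes> z \<otimes> v = u \<otimes> v \<otimes> z" "u \<otimes> z \<otimes> inv v = u \<otimes> inv v \<otimes> z"
      "u \<otimes> inv z \<otimes> v = u \<otimes> v \<otimes> inv z" "u \<otimes> inv z \<otimes> inv v = u \<otimes> inv v \<otimes> inv z"
      using u v z by (simp_all add: m_ac)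
    then show ?thesis
      using q[of "u \<otimes> z" v] q[of "u \<otimes> inv z" v] u v z by (simp add: F)
  qed
  have q_inv: "q (inv v) = q v" if "v \<in> carrier G" for v
    using q[of \<one> v] q[of \<one> \<one>] that by simp
  have F_one: "F \<one> = 0"
    using q_inv z by (simp add: F)
  have F_inv: "F (inv v) = - F v" if "v \<in> carrier G" for v
    using jensen[of \<one> v] F_one that by simp
  \<comment> \<open>The mixed terms of the Jensen equations for \<open>x, y\<close> and
    \<open>y, x\<close> are opposite and cancel in their sum.\<close>
  have "inv (y \<otimes> inv x) = x \<otimes> inv y"
    using x y by (simp add: inv_mult m_comm)
  then have "F (x \<otimes> inv y) = - F (y \<otimes> inv x)"
    using F_inv[of "y \<otimes> inv x"] x y by simp
  then show ?thesis
    using jensen[OF x y] jensen[OF y x] m_comm[OF x y] by simp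
qed

text \<open>
  The hypotheses force \<open>{\<tau> (x y), \<tau> (x y\<inverse>)} = {\<tau> x + \<tau> y, \<bar>\<tau> x - \<tau> y\<bar>}\<close>, so \<open>\<tau>\<^sup>2\<close> satisfies the
  parallelogram law and polarises to a form of rank one.
\<close>

lemma (in comm_group) hyperbolic_seminorm_eq_abs_additive:
  fixes \<tau> :: "'a \<Rightarrow> real"
  assumes nonneg: "\<And>x. x \<in> carrier G \<Longrightarrow> 0 \<le> \<tau> x"
    and inv: "\<And>x. x \<in> carrier G \<Longrightarrow> \<tau> (inv x) = \<tau> x"
    and double: "\<And>x. x \<in> carrier G \<Longrightarrow> \<tau> (x \<otimes> x) = 2 * \<tau> x"
    and subadd: "\<And>x y. x \<in> carrier G \<Longrightarrow> y \<in> carrier G \<Longrightarrow> \<tau> (x \<otimes> y) \<le> \<tau> x + \<tau> y"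
    and hyp: "\<And>x y. x \<in> carrier G \<Longrightarrow> y \<in> carrier G \<Longrightarrow>
        \<tau> (x \<otimes> y) + \<tau> (x \<otimes> inv y) \<le> 2 * max (\<tau> x) (\<tau> y)"
    and z: "z \<in> carrier G" "\<tau> z > 0"
  shows "\<exists>\<beta>. (\<forall>x\<in>carrier G. \<forall>y\<in>carrier G. \<beta> (x \<otimes> y) = \<beta> x + \<beta> y) \<and>
             (\<forall>x\<in>carrier G. \<bar>\<beta> x\<bar> = \<tau> x)"
proof -
  have sum_diff: "(\<tau> (x \<otimes> y) = \<tau> x + \<tau> y \<and> \<tau> (x \<otimes> inv y) = \<bar>\<tau> x - \<tau> y\<bar>) \<or>
                  (\<tau> (x \<otimes> inv y) = \<tau> x + \<tau> y \<and> \<tau> (x \<otimes> y) = \<bar>\<tau> x - \<tau> y\<bar>)"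
    if x: "x \<in> carrier G" and y: "y \<in> carrier G" for x y
  proof -
    let ?s = "x \<otimes> y" and ?d = "x \<otimes> inv y"
    have sd: "?s \<in> carrier G" "?d \<in> carrier G"
      using x y by auto
    have "?s \<otimes> ?d = (x \<otimes> x) \<otimes> (y \<otimes> inv y)"
      using x y by (simp only: m_ac m_closed inv_closed)
    then have s_mult_d: "?s \<otimes> ?d = x \<otimes> x"
      using x y by simp
    have "?s \<otimes> inv ?d = (x \<otimes> inv x) \<otimes> (y \<otimes> y)"
      using x y by (simp only: inv_mult inv_inv m_ac m_closed inv_closed)
    then have s_div_d: "?s \<otimes> inv ?d = y \<otimes> y"
      using x y by simp
    \<comment> \<open>Here \<open>hyp\<close> is applied to \<open>?s\<close> and \<open>?d\<close>:
      their product and quotient are the squares of \<open>x\<close> and \<open>y\<close>, so the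
      larger of \<open>\<tau> ?s\<close>, \<open>\<tau> ?d\<close> attains the subadditive
      bound.\<close>
    have "2 * \<tau> x + 2 * \<tau> y \<le> 2 * max (\<tau> ?s) (\<tau> ?d)"
      using hyp[OF sd] double x y by (simp add: s_mult_d s_div_d)
    moreover have "\<tau> ?s \<le> \<tau> x + \<tau> y" "\<tau> ?d \<le> \<tau> x + \<tau> y"
      using subadd[OF x y] subadd[OF x inv_closed[OF y]] inv[OF y] by auto
    moreover have "2 * \<tau> x \<le> \<tau> ?s + \<tau> ?d"
      using subadd[OF sd] double[OF x] by (simp add: s_mult_d)
    moreover have "2 * \<tau> y \<le> \<tau> ?s + \<tau> ?d"
      using subadd[OF sd(1) inv_closed[OF sd(2)]] double[OF y] inv[OF sd(2)]
      by (simp add: s_div_d)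
    ultimately show ?thesis
      using hyp[OF x y] by (smt (verit, best))
  qed
  define F where "F = (\<lambda>x. (\<tau> (x \<otimes> z))\<^sup>2 - (\<tau> (x \<otimes> inv z))\<^sup>2)"
  have "(\<tau> (x \<otimes> y))\<^sup>2 + (\<tau> (x \<otimes> inv y))\<^sup>2 = 2 * (\<tau> x)\<^sup>2 + 2 * (\<tau> y)\<^sup>2"
    if "x \<in> carrier G" "y \<in> carrier G" for x y
    using sum_diff[OF that] by (auto simp: power2_eq_square algebra_simps)
  then have F_add: "F (x \<otimes> y) = F x + F y" if "x \<in> carrier G" "y \<in> carrier G" for x y
    using parallelogram_imp_additive[of "\<lambda>x. (\<tau> x)\<^sup>2", OF _ z(1) F_def that] by simp
  have F_abs: "\<bar>F x\<bar> = 4 * \<tau> z * \<tau> x" if x: "x \<in> carrier G" for x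
  proof -
    \<comment> \<open>Up to sign, \<open>F x\<close> is the square of the sum of
      \<open>\<tau> x\<close> and \<open>\<tau> z\<close> minus the square of their difference; this
      is the source of the normalising factor \<open>4 * \<tau> z\<close>.\<close>
    have "F x = 4 * \<tau> z * \<tau> x \<or> F x = - (4 * \<tau> z * \<tau> x)"
      using sum_diff[OF x z(1)] by (auto simp: F_def power2_eq_square algebra_simps)
    then show ?thesis
      using nonneg[OF x] z(2) by (auto simp: abs_mult)
  qed
  show ?thesis
    using F_add F_abs z(2)
    by (intro exI[of _ "\<lambda>x. F x / (4 * \<tau> z)"]) (auto simp: add_divide_distrib)
qed

section \<open>Stable translation length\<close>

text \<open>The model is the displacement of a base point \<open>x\<close>, with \<open>C\<close>
  the error of the four-point condition. For commuting \<open>g\<close>, \<open>h\<close> the points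
  \<open>x, g x, g h x, h x\<close> form a quadrilateral with opposite sides equal.\<close>

locale hyperbolic_length = group G for G (structure) +
  fixes len :: "'a \<Rightarrow> real" and C :: real
  assumes len_nonneg: "g \<in> carrier G \<Longrightarrow> 0 \<le> len g"
    and len_inv: "g \<in> carrier G \<Longrightarrow> len (inv g) = len g"
    and len_mult: "g \<in> carrier G \<Longrightarrow> h \<in> carrier G \<Longrightarrow> len (g \<otimes> h) \<le> len g + len h"
    and len_four_point: "g \<in> carrier G \<Longrightarrow> h \<in> carrier G \<Longrightarrow> g \<otimes> h = h \<otimes> g \<Longrightarrow>
      len (g \<otimes> h) + len (g \<otimes> inv h) \<le> 2 * max (len g) (len h) + C"
begin

text \<open>The limit runs along powers of two, where \<open>len_mult\<close> makes the quotients
  decrease and squaring \<open>g\<close> only shifts the sequence.\<close>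

definition stable_len :: "'a \<Rightarrow> real" where
  "stable_len g = lim (\<lambda>k. len (g [^] (2 ^ k :: nat)) / 2 ^ k)"

lemma stable_len_tendsto:
  assumes g: "g \<in> carrier G"
  shows "(\<lambda>k. len (g [^] (2 ^ k :: nat)) / 2 ^ k) \<longlonglongrightarrow> stable_len g"
proof -
  let ?X = "\<lambda>k. len (g [^] (2 ^ k :: nat)) / 2 ^ k"
  have "decseq ?X"
  proof (rule decseq_SucI)
    fix k
    have "g [^] (2 ^ Suc k :: nat) = g [^] (2 ^ k :: nat) \<otimes> g [^] (2 ^ k :: nat)"
      using g by (simp add: nat_pow_mult mult_2)
    then have "len (g [^] (2 ^ Suc k :: nat)) \<le> 2 * len (g [^] (2 ^ k :: nat))"
      using len_mult[of "g [^] (2 ^ k :: nat)" "g [^] (2 ^ k :: nat)"] g by simp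
    then show "?X (Suc k) \<le> ?X k"
      by (simp add: field_simps)
  qed
  moreover have "\<forall>k. 0 \<le> ?X k"
    using len_nonneg g by simp
  ultimately obtain L where "?X \<longlonglongrightarrow> L"
    using decseq_convergent[of ?X 0] by blast
  then have "convergent ?X"
    by (rule convergentI)
  then show ?thesis
    by (simp add: stable_len_def convergent_LIMSEQ_iff)
qed

lemma stable_len_unique:
  assumes "g \<in> carrier G" "(\<lambda>k. len (g [^] (2 ^ k :: nat)) / 2 ^ k) \<longlonglongrightarrow> l"
  shows "stable_len g = l"
  using LIMSEQ_unique stable_len_tendsto assms by blast

lemma stable_len_nonneg: "g \<in> carrier G \<Longrightarrow> 0 \<le> stable_len g"
  by (rule LIMSEQ_le_const[OF stable_len_tendsto]) (auto simp: len_nonneg)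

lemma stable_len_inv: "g \<in> carrier G \<Longrightarrow> stable_len (inv g) = stable_len g"
  by (rule stable_len_unique) (use stable_len_tendsto in \<open>simp_all add: nat_pow_inv len_inv\<close>)

lemma stable_len_double:
  assumes g: "g \<in> carrier G"
  shows "stable_len (g \<otimes> g) = 2 * stable_len g"
proof (rule stable_len_unique)
  have "(g \<otimes> g) [^] (2 ^ k :: nat) = g [^] (2 ^ Suc k :: nat)" for k :: nat
    using g by (simp add: pow_mult_distrib nat_pow_mult mult_2)
  then show "(\<lambda>k. len ((g \<otimes> g) [^] (2 ^ k :: nat)) / 2 ^ k) \<longlonglongrightarrow> 2 * stable_len g"
    using tendsto_mult[OF tendsto_const[of 2] LIMSEQ_Suc[OF stable_len_tendsto[OF g]]] by simp
qed (use g in simp)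

text \<open>Conjugating a power costs at most \<open>2 * len g\<close>, whatever the exponent, and
  division by \<open>2 ^ k\<close> removes this in the limit.\<close>

lemma stable_len_conj_le:
  assumes g: "g \<in> carrier G" and y: "y \<in> carrier G"
  shows "stable_len (g \<otimes> y \<otimes> inv g) \<le> stable_len y"
proof -
  have "len (g \<otimes> y [^] n \<otimes> inv g) \<le> len (y [^] n) + 2 * len g" for n :: nat
    using len_mult[of "g \<otimes> y [^] n" "inv g"] len_mult[of g "y [^] n"] len_inv[of g] g y by simp
  then have le: "len ((g \<otimes> y \<otimes> inv g) [^] (2 ^ k :: nat)) / 2 ^ k
      \<le> len (y [^] (2 ^ k :: nat)) / 2 ^ k + 2 * len g / 2 ^ k" for k
    by (simp add: conj_nat_pow[OF g y] divide_right_mono flip: add_divide_distrib)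
  have "(\<lambda>k. 2 * len g / 2 ^ k) \<longlonglongrightarrow> 0"
    by (rule LIMSEQ_divide_realpow_zero) simp
  from tendsto_add[OF stable_len_tendsto[OF y] this] show ?thesis
    using LIMSEQ_le[OF stable_len_tendsto[of "g \<otimes> y \<otimes> inv g"]] le g y by fastforce
qed

lemma stable_len_conj:
  assumes g: "g \<in> carrier G" and y: "y \<in> carrier G"
  shows "stable_len (g \<otimes> y \<otimes> inv g) = stable_len y"
proof (rule antisym[OF stable_len_conj_le[OF g y]])
  have "inv g \<otimes> (g \<otimes> y \<otimes> inv g) \<otimes> inv (inv g) = (inv g \<otimes> g) \<otimes> y \<otimes> (inv g \<otimes> g)"
    using g y by (simp only: m_assoc m_closed inv_closed inv_inv)
  then show "stable_len y \<le> stable_len (g \<otimes> y \<otimes> inv g)"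
    using stable_len_conj_le[of "inv g" "g \<otimes> y \<otimes> inv g"] g y by simp
qed

lemma stable_len_mult:
  assumes g: "g \<in> carrier G" and h: "h \<in> carrier G" and gh: "g \<otimes> h = h \<otimes> g"
  shows "stable_len (g \<otimes> h) \<le> stable_len g + stable_len h"
proof -
  have "len ((g \<otimes> h) [^] (2 ^ k :: nat)) / 2 ^ k
      \<le> len (g [^] (2 ^ k :: nat)) / 2 ^ k + len (h [^] (2 ^ k :: nat)) / 2 ^ k" for k
    using len_mult[of "g [^] (2 ^ k :: nat)" "h [^] (2 ^ k :: nat)"] g h
    by (simp add: pow_mult_distrib[OF gh g h] divide_right_mono flip: add_divide_distrib)
  then show ?thesis
    using LIMSEQ_le[OF stable_len_tendsto[of "g \<otimes> h"]
        tendsto_add[OF stable_len_tendsto[OF g] stable_len_tendsto[OF h]]] g h by auto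
qed

text \<open>Powers of commuting elements commute, so \<open>len_four_point\<close> applies at every
  scale \<open>2 ^ k\<close>; its error shrinks to \<open>C / 2 ^ k\<close>.\<close>

lemma stable_len_four_point:
  assumes g: "g \<in> carrier G" and h: "h \<in> carrier G" and gh: "g \<otimes> h = h \<otimes> g"
  shows "stable_len (g \<otimes> h) + stable_len (g \<otimes> inv h) \<le> 2 * max (stable_len g) (stable_len h)"
proof -
  have gh': "g \<otimes> inv h = inv h \<otimes> g"
    using g h gh by (metis inv_closed inv_solve_left inv_solve_right m_assoc m_closed)
  have le: "len ((g \<otimes> h) [^] (2 ^ k :: nat)) / 2 ^ k + len ((g \<otimes> inv h) [^] (2 ^ k :: nat)) / 2 ^ k
      \<le> 2 * max (len (g [^] (2 ^ k :: nat)) / 2 ^ k) (len (h [^] (2 ^ k :: nat)) / 2 ^ k) + C / 2 ^ k"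
    for k
  proof -
    let ?g = "g [^] (2 ^ k :: nat)" and ?h = "h [^] (2 ^ k :: nat)"
    have "?g \<otimes> ?h = ?h \<otimes> ?g"
      using pow_mult_distrib[OF gh g h] pow_mult_distrib[OF gh[symmetric] h g] gh by metis
    then have "(len (?g \<otimes> ?h) + len (?g \<otimes> inv ?h)) / 2 ^ k
        \<le> (2 * max (len ?g) (len ?h) + C) / 2 ^ k"
      using len_four_point[of ?g ?h] g h by (simp add: divide_right_mono)
    moreover have "max (len ?g) (len ?h) / 2 ^ k = max (len ?g / 2 ^ k) (len ?h / 2 ^ k)"
      by (simp add: max_def divide_le_cancel)
    ultimately show ?thesis
      using g h
      by (simp add: pow_mult_distrib[OF gh g h] pow_mult_distrib[OF gh' g inv_closed[OF h]]
          nat_pow_inv add_divide_distrib)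
  qed
  have "(\<lambda>k. C / 2 ^ k) \<longlonglongrightarrow> 0"
    by (rule LIMSEQ_divide_realpow_zero) simp
  then have "(\<lambda>k. 2 * max (len (g [^] (2 ^ k :: nat)) / 2 ^ k) (len (h [^] (2 ^ k :: nat)) / 2 ^ k)
      + C / 2 ^ k) \<longlonglongrightarrow> 2 * max (stable_len g) (stable_len h) + 0"
    by (intro tendsto_intros stable_len_tendsto g h)
  then show ?thesis
    using LIMSEQ_le[OF tendsto_add[OF stable_len_tendsto[of "g \<otimes> h"]
          stable_len_tendsto[of "g \<otimes> inv h"]]] le g h by auto
qed

lemma stable_len_pos:
  assumes z: "z \<in> carrier G" and c: "c > 0" "\<And>k::nat. len (z [^] k) \<ge> real k * c"
  shows "stable_len z > 0"
proof -
  have "c \<le> len (z [^] (2 ^ k :: nat)) / 2 ^ k" for k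
    using c(2)[of "2 ^ k"] by (simp add: field_simps)
  then have "c \<le> stable_len z"
    using LIMSEQ_le_const[OF stable_len_tendsto[OF z]] by blast
  then show ?thesis
    using c(1) by simp
qed

text \<open>All pairs in \<open>A\<close> commute, so the facts on stable lengths supply the
  hypotheses of \<open>hyperbolic_seminorm_eq_abs_additive\<close>.\<close>

lemma stable_len_eq_abs_additive:
  assumes A: "subgroup A G" "comm_group (G\<lparr>carrier := A\<rparr>)"
    and z: "z \<in> A" "stable_len z > 0"
  shows "\<exists>\<beta>. (\<forall>x\<in>A. \<forall>y\<in>A. \<beta> (x \<otimes> y) = \<beta> x + \<beta> y) \<and> (\<forall>x\<in>A. \<bar>\<beta> x\<bar> = stable_len x)"
proof -
  interpret H: comm_group "G\<lparr>carrier := A\<rparr>"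
    by (rule A(2))
  have AG: "x \<in> carrier G" if "x \<in> A" for x
    using subgroup.mem_carrier[OF A(1)] that .
  have comm: "x \<otimes> y = y \<otimes> x" if "x \<in> A" "y \<in> A" for x y
    using H.m_comm[of x y] that by simp
  show ?thesis
    using H.hyperbolic_seminorm_eq_abs_additive[of stable_len z]
    by (simp add: AG comm z m_inv_consistent[OF A(1)] stable_len_nonneg stable_len_inv
        stable_len_double stable_len_mult stable_len_four_point)
qed

end

section \<open>Displacement in a hyperbolic space\<close>

text \<open>For commuting \<open>g\<close>, \<open>h\<close> the diagonals of the quadrilateral
  \<open>x, g x, g h x, h x\<close> are the displacements of \<open>g h\<close> and
  \<open>inv h g\<close>, and its opposite sides are equal, so the four-point condition bounds the
  sum of the diagonals by twice the longer side plus an error.\<close>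

lemma hyperbolic_length_displacement:
  assumes hyp: "hyperbolic_space X d" and act: "isometric_action G X d \<rho>" and x: "x \<in> X"
  shows "\<exists>C. hyperbolic_length G (\<lambda>g. d (\<rho> g x) x) C"
proof -
  interpret M: Metric_space X d
    using hyp by (simp add: hyperbolic_space_def geodesic_space_def)
  interpret act: group_action G X \<rho>
    using act by (simp add: isometric_action_def)
  interpret group G
    using act.group_hom group_hom.axioms(1) by auto
  obtain \<delta> where \<delta>: "\<And>w x y z. w \<in> X \<Longrightarrow> x \<in> X \<Longrightarrow> y \<in> X \<Longrightarrow> z \<in> X \<Longrightarrow>
      gromov_product d w x z \<ge> min (gromov_product d w x y) (gromov_product d w y z) - \<delta>"
    using hyp unfolding hyperbolic_space_def by blast
  \<comment> \<open>Gromov products are based at \<open>s\<close>; clearing their halves doubles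
    \<open>\<delta>\<close>.\<close>
  have four_point: "d p r + d q s \<le> max (d p q + d r s) (d q r + d p s) + 2 * \<delta>"
    if "p \<in> X" "q \<in> X" "r \<in> X" "s \<in> X" for p q r s
    using \<delta>[OF that(4,1,2,3)] 
    unfolding gromov_product_def add_divide_distrib diff_divide_distrib by linarith
  have iso: "d (\<rho> g u) (\<rho> g v) = d u v" if "g \<in> carrier G" "u \<in> X" "v \<in> X" for g u v
    using act that by (simp add: isometric_action_def)
  have im: "\<rho> g u \<in> X" if "g \<in> carrier G" "u \<in> X" for g u
    using act.element_image that by blast
  note comp = act.composition_rule[OF x]
  have inv_left: "d (\<rho> (inv\<^bsub>G\<^esub> h \<otimes>\<^bsub>G\<^esub> g) x) x = d (\<rho> g x) (\<rho> h x)"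
    if "g \<in> carrier G" "h \<in> carrier G" for g h
    using iso[of h "\<rho> (inv\<^bsub>G\<^esub> h \<otimes>\<^bsub>G\<^esub> g) x" x] comp[of h "inv\<^bsub>G\<^esub> h \<otimes>\<^bsub>G\<^esub> g"] that im x
    by (simp add: m_assoc[symmetric])
  have one: "\<rho> \<one>\<^bsub>G\<^esub> x = x"
    using act.id_eq_one x by (metis restrict_apply')
  have "hyperbolic_length G (\<lambda>g. d (\<rho> g x) x) (2 * \<delta>)"
  proof
    fix g assume g: "g \<in> carrier G"
    show "d (\<rho> (inv\<^bsub>G\<^esub> g) x) x = d (\<rho> g x) x"
      using inv_left[OF one_closed g] g one by (simp add: M.commute)
  next
    fix g h assume g: "g \<in> carrier G" and h: "h \<in> carrier G"
    show "d (\<rho> (g \<otimes>\<^bsub>G\<^esub> h) x) x \<le> d (\<rho> g x) x + d (\<rho> h x) x"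
      using M.triangle[of "\<rho> (g \<otimes>\<^bsub>G\<^esub> h) x" "\<rho> g x" x] iso[of g "\<rho> h x" x] g h x im comp by simp
    assume gh: "g \<otimes>\<^bsub>G\<^esub> h = h \<otimes>\<^bsub>G\<^esub> g"
    have gh': "g \<otimes>\<^bsub>G\<^esub> inv\<^bsub>G\<^esub> h = inv\<^bsub>G\<^esub> h \<otimes>\<^bsub>G\<^esub> g"
      using g h gh by (metis inv_closed inv_solve_left inv_solve_right m_assoc m_closed)
    have "d (\<rho> (g \<otimes>\<^bsub>G\<^esub> h) x) (\<rho> g x) = d (\<rho> h x) x" "d (\<rho> (g \<otimes>\<^bsub>G\<^esub> h) x) (\<rho> h x) = d (\<rho> g x) x"
      using iso[of g "\<rho> h x" x] iso[of h "\<rho> g x" x] comp[of g h] comp[of h g] g h x im gh by auto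
    then show "d (\<rho> (g \<otimes>\<^bsub>G\<^esub> h) x) x + d (\<rho> (g \<otimes>\<^bsub>G\<^esub> inv\<^bsub>G\<^esub> h) x) x
        \<le> 2 * max (d (\<rho> g x) x) (d (\<rho> h x) x) + 2 * \<delta>"
      using four_point[of "\<rho> (g \<otimes>\<^bsub>G\<^esub> h) x" "\<rho> g x" x "\<rho> h x"] g h x im
      unfolding gh' inv_left[OF g h] by (simp add: M.commute[of x])
  qed simp
  then show ?thesis ..
qed

section \<open>Modular matrices\<close>

text \<open>
  A matrix in \<open>S\<close> is determined by its signs \<open>\<epsilon>\<close> on a finite family of the \<open>b\<close> spanning all of them,
  unless some non-zero rational vector, a column of a difference, is orthogonal to every \<open>b\<close>.
\<close>

lemma infinite_rat_matrices_imp_orthogonal_int_vector: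
  fixes S :: "(rat^'n^'n) set"
  assumes S: "infinite S"
  shows "\<exists>k :: 'n \<Rightarrow> int. k \<noteq> (\<lambda>_. 0) \<and>
    (\<forall>b :: 'n \<Rightarrow> real.
       (\<forall>M\<in>S. \<exists>\<epsilon>\<in>{1, -1}. \<forall>j. (\<Sum>i\<in>UNIV. b i * of_rat (M $ i $ j)) = \<epsilon> * b j) \<longrightarrow>
       (\<Sum>i\<in>UNIV. b i * of_int (k i)) = 0)"
proof -
  define B :: "(real^'n) set" where
    "B = {b. \<forall>M\<in>S. \<exists>\<epsilon>\<in>{1, -1}. \<forall>j. (\<Sum>i\<in>UNIV. b $ i * of_rat (M $ i $ j)) = \<epsilon> * b $ j}"
  \<comment> \<open>\<open>B\<close> need not be a subspace, since the sign may vary with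
    \<open>b\<close>. The basis of its span is taken inside \<open>B\<close>, so that each basis
    vector has a sign for every matrix.\<close>
  obtain B0 where B0: "B0 \<subseteq> B" "independent B0" "B \<subseteq> span B0"
    using basis_exists[of B] by metis
  have "finite B0"
    using B0(2) by (rule independent_imp_finite)
  \<comment> \<open>Vectors of \<open>B0\<close> outside this set have sign -1, so the set encodes
    all signs; by pigeonhole two distinct matrices in \<open>S\<close> share it.\<close>
  define sgn_on where
    "sgn_on M = {b \<in> B0. \<forall>j. (\<Sum>i\<in>UNIV. b $ i * of_rat (M $ i $ j)) = b $ j}" for M :: "rat^'n^'n"
  have "finite (sgn_on ` S)"
    by (rule finite_subset[of _ "Pow B0"]) (auto simp: sgn_on_def \<open>finite B0\<close>)
  then have "\<not> inj_on sgn_on S"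
    using S finite_imageD by blast
  then obtain M M' where M: "M \<in> S" "M' \<in> S" "sgn_on M = sgn_on M'" "M \<noteq> M'"
    by (auto simp: inj_on_def)
  then obtain i0 j where ij: "M $ i0 $ j \<noteq> M' $ i0 $ j"
    by (metis vec_eq_iff)
  \<comment> \<open>Equal signs make this column difference orthogonal to \<open>B0\<close>, hence
    by linearity to all of \<open>B\<close>.\<close>
  define v where "v = (\<lambda>i. M $ i $ j - M' $ i $ j)"
  have orth0: "b \<bullet> (\<chi> i. of_rat (v i)) = 0" if b: "b \<in> B0" for b
  proof -
    have "(\<Sum>i\<in>UNIV. b $ i * of_rat (M $ i $ j)) = (\<Sum>i\<in>UNIV. b $ i * of_rat (M' $ i $ j))"
    proof (cases "b \<in> sgn_on M")
      case True
      then have "b \<in> sgn_on M'"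
        using M by simp
      with True show ?thesis
        by (simp add: sgn_on_def)
    next
      case False
      have "(\<Sum>i\<in>UNIV. b $ i * of_rat (N $ i $ j)) = - b $ j" if N: "N \<in> S" "b \<notin> sgn_on N" for N
      proof -
        have "b \<in> B"
          using b B0 by blast
        then obtain \<epsilon> :: real where "\<epsilon> \<in> {1, -1}"
            "\<forall>j. (\<Sum>i\<in>UNIV. b $ i * of_rat (N $ i $ j)) = \<epsilon> * b $ j"
          using N(1) unfolding B_def by blast
        then show ?thesis
          using N(2) b by (auto simp: sgn_on_def)
      qed
      then show ?thesis
        using False M by simp
    qed
    then show ?thesis
      by (simp add: inner_vec_def v_def of_rat_diff right_diff_distrib sum_subtractf)
  qed
  have orth: "b \<bullet> (\<chi> i. of_rat (v i)) = 0" if "b \<in> B" for b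
  proof -
    have "subspace {b :: real^'n. b \<bullet> (\<chi> i. of_rat (v i)) = 0}"
      by (auto simp: subspace_def inner_left_distrib)
    then have "span B0 \<subseteq> {b :: real^'n. b \<bullet> (\<chi> i. of_rat (v i)) = 0}"
      using orth0 by (intro span_minimal) auto
    then show ?thesis
      using that B0(3) by blast
  qed
  \<comment> \<open>A common denominator, which scales \<open>v\<close> to an integer
    vector.\<close>
  define D where "D = (\<Prod>i\<in>UNIV. snd (quotient_of (v i)))"
  have den_pos: "snd (quotient_of (v i)) > 0" for i
    by (simp add: quotient_of_denom_pos')
  have "D \<noteq> 0"
    using den_pos by (simp add: D_def less_imp_neq[symmetric])
  have "\<exists>m::int. of_int D * v i = of_int m" for i
  proof -
    have "snd (quotient_of (v i)) dvd D"
      unfolding D_def by (rule dvd_prodI) auto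
    then obtain c where c: "D = snd (quotient_of (v i)) * c"
      by (elim dvdE)
    have "v i = of_int (fst (quotient_of (v i))) / of_int (snd (quotient_of (v i)))"
      by (metis prod.collapse quotient_of_div)
    then have "of_int (snd (quotient_of (v i))) * v i = of_int (fst (quotient_of (v i)))"
      using den_pos[of i] by (simp add: field_simps)
    then have "of_int D * v i = of_int (c * fst (quotient_of (v i)))"
      by (simp add: c)
    then show ?thesis ..
  qed
  then obtain k where k: "\<And>i. of_int D * v i = of_int (k i)"
    by metis
  have "k i0 \<noteq> 0"
    using k[of i0] ij \<open>D \<noteq> 0\<close> by (auto simp: v_def)
  then have "k \<noteq> (\<lambda>_. 0)"
    by auto
  moreover have "(\<Sum>i\<in>UNIV. b i * of_int (k i)) = 0"
    if "\<forall>M\<in>S. \<exists>\<epsilon>\<in>{1, -1}. \<forall>j. (\<Sum>i\<in>UNIV. b i * of_rat (M $ i $ j)) = \<epsilon> * b j" for b :: "'n \<Rightarrow> real"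
  proof -
    have "(\<chi> i. b i) \<in> B"
      using that by (simp add: B_def)
    then have "(\<Sum>i\<in>UNIV. b i * of_rat (v i)) = 0"
      using orth by (fastforce simp: inner_vec_def)
    moreover have "real_of_int (k i) = of_int D * of_rat (v i)" for i
      by (metis k of_rat_mult of_rat_of_int_eq)
    then have "(\<Sum>i\<in>UNIV. b i * of_int (k i)) = of_int D * (\<Sum>i\<in>UNIV. b i * of_rat (v i))"
      by (simp add: sum_distrib_left mult_ac)
    ultimately show ?thesis
      by simp
  qed
  ultimately show ?thesis
    by blast
qed

section \<open>Integer coordinates and uniqueness of modular matrices\<close>

context
  fixes G :: "'g monoid" and A :: "'g set" and a :: "'n::finite \<Rightarrow> 'g"
  assumes G: "group G" and A: "subgroup A G" "comm_group (G\<lparr>carrier := A\<rparr>)"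
    and basis: "Z_basis G A a"
begin

interpretation group G by (rule G)
interpretation H: comm_group "G\<lparr>carrier := A\<rparr>" by (rule A(2))

lemma basis_mem: "a i \<in> A"
  using basis by (auto simp: Z_basis_def)

lemma basis_pow_mem: "a i [^]\<^bsub>G\<^esub> (m::int) \<in> A" "a i [^]\<^bsub>G\<^esub> (l::nat) \<in> A"
  using H.int_pow_closed[of "a i" m] H.nat_pow_closed[of "a i" l] basis_mem
  by (simp_all add: int_pow_consistent[OF A(1)] flip: nat_pow_consistent)

lemma power_product_closed: "power_product G A a k \<in> A"
  using H.finprod_closed[of "\<lambda>i. a i [^]\<^bsub>G\<^esub> k i" UNIV] basis_pow_mem
  by (auto simp: power_product_def)

lemma power_product_zero: "power_product G A a (\<lambda>_. 0) = \<one>\<^bsub>G\<^esub>"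
  using H.finprod_one[of UNIV] by (simp add: power_product_def)

lemma power_product_add:
  "power_product G A a (\<lambda>i. k i + l i) = power_product G A a k \<otimes>\<^bsub>G\<^esub> power_product G A a l"
proof -
  have "power_product G A a (\<lambda>i. k i + l i) =
      finprod (G\<lparr>carrier := A\<rparr>) (\<lambda>i. a i [^]\<^bsub>G\<^esub> k i \<otimes>\<^bsub>G\<^esub> a i [^]\<^bsub>G\<^esub> l i) UNIV"
    using basis_mem subgroup.mem_carrier[OF A(1)] by (simp add: power_product_def int_pow_mult)
  then show ?thesis
    using H.finprod_multf[of "\<lambda>i. a i [^]\<^bsub>G\<^esub> k i" UNIV "\<lambda>i. a i [^]\<^bsub>G\<^esub> l i"] basis_pow_mem
    by (simp add: power_product_def)
qed

lemma power_product_pow: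
  "power_product G A a k [^]\<^bsub>G\<^esub> (n::nat) = power_product G A a (\<lambda>i. int n * k i)"
proof (induction n)
  case (Suc n)
  then show ?case
    by (simp add: distrib_right power_product_add[symmetric] add.commute)
qed (simp add: power_product_zero)

lemma power_product_inject:
  assumes "power_product G A a k = power_product G A a l"
  shows "k = l"
  using basis assms power_product_closed unfolding Z_basis_def by metis

text \<open>Raising the conjugates of \<open>a j\<close> to the power \<open>m\<close> and to the
  power \<open>m'\<close> further to the powers \<open>m'\<close> and \<open>m\<close> gives the
  same element of \<open>A\<close>; uniqueness of coordinates makes the fractions agree.\<close>

lemma modular_matrix_unique:
  assumes g: "g \<in> carrier G" and M: "modular_matrix G A a g M" "modular_matrix G A a g M'"
  shows "M = M'"
proof -
  obtain m k where m: "m > 0" "M = (\<chi> i j. of_int (k i j) / of_nat m)"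
    and k: "\<And>j. g \<otimes>\<^bsub>G\<^esub> (a j [^]\<^bsub>G\<^esub> (m::nat)) \<otimes>\<^bsub>G\<^esub> inv\<^bsub>G\<^esub> g = power_product G A a (\<lambda>i. k i j)"
    using M(1) unfolding modular_matrix_def by blast
  obtain m' k' where m': "m' > 0" "M' = (\<chi> i j. of_int (k' i j) / of_nat m')"
    and k': "\<And>j. g \<otimes>\<^bsub>G\<^esub> (a j [^]\<^bsub>G\<^esub> (m'::nat)) \<otimes>\<^bsub>G\<^esub> inv\<^bsub>G\<^esub> g = power_product G A a (\<lambda>i. k' i j)"
    using M(2) unfolding modular_matrix_def by blast
  have "int m' * k i j = int m * k' i j" for i j
  proof -
    have aj: "a j \<in> carrier G"
      using basis_mem subgroup.mem_carrier[OF A(1)] by blast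
    have "power_product G A a (\<lambda>i. k i j) [^]\<^bsub>G\<^esub> m' = power_product G A a (\<lambda>i. k' i j) [^]\<^bsub>G\<^esub> m"
      unfolding k[symmetric] k'[symmetric] using g aj
      by (simp add: conj_nat_pow nat_pow_pow mult.commute)
    then have "(\<lambda>i. int m' * k i j) = (\<lambda>i. int m * k' i j)"
      by (intro power_product_inject) (simp add: power_product_pow)
    then show ?thesis
      by (rule fun_cong)
  qed
  then have "of_nat m' * of_int (k i j) = (of_nat m * of_int (k' i j) :: rat)" for i j
    by (metis of_int_mult of_int_of_nat_eq)
  then show ?thesis
    using m m' by (simp add: vec_eq_iff frac_eq_eq mult.commute)
qed

text \<open>
  If \<open>g\<close> has no modular matrix, then \<open>modular_hom G A a g\<close> is the junk value \<open>THE M. False\<close>, the same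
  for all such \<open>g\<close>, so it adds at most one element to the monodromy.
\<close>

lemma infinite_modular_matrices:
  assumes "infinite (monodromy G A a)"
  shows "infinite {M. \<exists>g\<in>carrier G. modular_matrix G A a g M}" (is "infinite ?S")
proof
  assume "finite ?S"
  moreover have "monodromy G A a \<subseteq> insert (THE M. False) ?S"
  proof
    fix N
    assume "N \<in> monodromy G A a"
    then obtain g where g: "g \<in> carrier G" "N = (THE M. modular_matrix G A a g M)"
      by (auto simp: monodromy_def modular_hom_def)
    show "N \<in> insert (THE M. False) ?S"
    proof (cases "\<exists>M. modular_matrix G A a g M")
      case True
      then have "modular_matrix G A a g N"
        using modular_matrix_unique[OF g(1)] g(2) by (metis theI)
      then show ?thesis
        using g(1) by blast
    qed (use g in simp)
  qed
  ultimately show False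
    using assms finite_subset by blast
qed

section \<open>Additive functions on \<open>A\<close> as eigenvectors of modular matrices\<close>

context
  fixes \<beta> :: "'g \<Rightarrow> real"
  assumes add: "\<And>x y. x \<in> A \<Longrightarrow> y \<in> A \<Longrightarrow> \<beta> (x \<otimes>\<^bsub>G\<^esub> y) = \<beta> x + \<beta> y"
begin

lemma additive_one: "\<beta> \<one>\<^bsub>G\<^esub> = 0"
  using add[of "\<one>\<^bsub>G\<^esub>" "\<one>\<^bsub>G\<^esub>"] subgroup.one_closed[OF A(1)] by simp

lemma additive_nat_pow: "\<beta> (a i [^]\<^bsub>G\<^esub> (n::nat)) = real n * \<beta> (a i)"
  by (induction n) (simp_all add: additive_one add basis_pow_mem basis_mem algebra_simps)

lemma additive_int_pow: "\<beta> (a i [^]\<^bsub>G\<^esub> (k::int)) = of_int k * \<beta> (a i)"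
proof (cases k rule: int_cases2)
  case (nonneg n)
  then show ?thesis
    by (simp add: int_pow_int additive_nat_pow)
next
  case (nonpos n)
  let ?x = "a i [^]\<^bsub>G\<^esub> n"
  have x: "?x \<in> A"
    by (rule basis_pow_mem)
  then have "inv\<^bsub>G\<^esub> ?x \<otimes>\<^bsub>G\<^esub> ?x = \<one>\<^bsub>G\<^esub>"
    by (intro l_inv subgroup.mem_carrier[OF A(1)])
  then have "\<beta> (inv\<^bsub>G\<^esub> ?x) + \<beta> ?x = 0"
    using add[OF subgroup.m_inv_closed[OF A(1) x] x] additive_one by simp
  moreover have "a i [^]\<^bsub>G\<^esub> k = inv\<^bsub>G\<^esub> ?x"
    unfolding nonpos by (intro int_pow_neg_int subgroup.mem_carrier[OF A(1)] basis_mem)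
  ultimately show ?thesis
    by (simp add: nonpos additive_nat_pow)
qed

lemma additive_power_product:
  "\<beta> (power_product G A a k) = (\<Sum>i\<in>UNIV. \<beta> (a i) * of_int (k i))"
proof -
  have "\<beta> (finprod (G\<lparr>carrier := A\<rparr>) (\<lambda>i. a i [^]\<^bsub>G\<^esub> k i) I) = (\<Sum>i\<in>I. \<beta> (a i) * of_int (k i))"
    if "finite I" for I
    using that
  proof (induction I rule: finite_induct)
    case empty
    show ?case
      by (simp add: additive_one)
  next
    case (insert j I)
    have "finprod (G\<lparr>carrier := A\<rparr>) (\<lambda>i. a i [^]\<^bsub>G\<^esub> k i) I \<in> A"
      using H.finprod_closed[of "\<lambda>i. a i [^]\<^bsub>G\<^esub> k i" I] basis_pow_mem by auto
    then show ?case
      using H.finprod_insert[of I j "\<lambda>i. a i [^]\<^bsub>G\<^esub> k i"] insert basis_pow_mem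
      by (simp add: add additive_int_pow mult.commute)
  qed
  then show ?thesis
    by (simp add: power_product_def)
qed

text \<open>Invariance of \<bar>\<beta>\<bar> on the \<open>p j\<close> gives a sign for each
  \<open>j\<close>; invariance on the products of two of them makes the signs agree.
  \<open>conj\<close> speaks only of conjugates that stay in \<open>A\<close>, because
  \<open>g\<close> need not normalise \<open>A\<close>.\<close>

lemma modular_matrix_eigenvector:
  assumes g: "g \<in> carrier G" and M: "modular_matrix G A a g M"
    and conj: "\<And>y. y \<in> A \<Longrightarrow> g \<otimes>\<^bsub>G\<^esub> y \<otimes>\<^bsub>G\<^esub> inv\<^bsub>G\<^esub> g \<in> A \<Longrightarrow>
      \<bar>\<beta> (g \<otimes>\<^bsub>G\<^esub> y \<otimes>\<^bsub>G\<^esub> inv\<^bsub>G\<^esub> g)\<bar> = \<bar>\<beta> y\<bar>"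
  shows "\<exists>\<epsilon>\<in>{1, -1}. \<forall>j. (\<Sum>i\<in>UNIV. \<beta> (a i) * of_rat (M $ i $ j)) = \<epsilon> * \<beta> (a j)"
proof -
  obtain m k where m: "m > 0" "M = (\<chi> i j. of_int (k i j) / of_nat m)"
    and k: "\<And>j. g \<otimes>\<^bsub>G\<^esub> (a j [^]\<^bsub>G\<^esub> (m::nat)) \<otimes>\<^bsub>G\<^esub> inv\<^bsub>G\<^esub> g = power_product G A a (\<lambda>i. k i j)"
    using M unfolding modular_matrix_def by blast
  define p r where "p = (\<lambda>j. a j [^]\<^bsub>G\<^esub> m)" and "r = (\<lambda>j. power_product G A a (\<lambda>i. k i j))"
  have pA: "p j \<in> A" and rA: "r j \<in> A" for j
    by (simp_all add: p_def r_def basis_pow_mem power_product_closed)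
  have pG: "p j \<in> carrier G" for j
    using subgroup.mem_carrier[OF A(1) pA] .
  have conj_p: "g \<otimes>\<^bsub>G\<^esub> p j \<otimes>\<^bsub>G\<^esub> inv\<^bsub>G\<^esub> g = r j" for j
    using k by (simp add: p_def r_def)
  have abs1: "\<bar>\<beta> (r j)\<bar> = \<bar>\<beta> (p j)\<bar>" for j
    using conj[of "p j"] pA rA conj_p by simp
  have abs2: "\<bar>\<beta> (r i) + \<beta> (r j)\<bar> = \<bar>\<beta> (p i) + \<beta> (p j)\<bar>" for i j
  proof -
    have "g \<otimes>\<^bsub>G\<^esub> (p i \<otimes>\<^bsub>G\<^esub> p j) \<otimes>\<^bsub>G\<^esub> inv\<^bsub>G\<^esub> g = r i \<otimes>\<^bsub>G\<^esub> r j"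
      using conj_mult[OF g pG pG] by (simp add: conj_p)
    then show ?thesis
      using conj[of "p i \<otimes>\<^bsub>G\<^esub> p j"] pA rA by (simp add: subgroup.m_closed[OF A(1)] add)
  qed
  have "(\<forall>j. \<beta> (r j) = \<beta> (p j)) \<or> (\<forall>j. \<beta> (r j) = - \<beta> (p j))"
  proof (rule ccontr)
    assume "\<not> ?thesis"
    then obtain i j where "\<beta> (r i) \<noteq> \<beta> (p i)" "\<beta> (r j) \<noteq> - \<beta> (p j)"
      by blast
    \<comment> \<open>Here \<open>\<beta> (r i) = - \<beta> (p i)\<close> and
      \<open>\<beta> (r j) = \<beta> (p j)\<close> with both values nonzero, but then
      \<open>abs2\<close> would force one of them to vanish.\<close>
    then show False
      using abs1[of i] abs1[of j] abs2[of i j] by (auto simp: abs_if split: if_splits)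
  qed
  then obtain \<epsilon> :: real where \<epsilon>: "\<epsilon> \<in> {1, -1}" "\<And>j. \<beta> (r j) = \<epsilon> * \<beta> (p j)"
    by force
  have "(\<Sum>i\<in>UNIV. \<beta> (a i) * of_rat (M $ i $ j)) = \<epsilon> * \<beta> (a j)" for j
  proof -
    have "(\<Sum>i\<in>UNIV. \<beta> (a i) * of_rat (M $ i $ j)) = \<beta> (r j) / real m"
      by (simp add: m(2) r_def additive_power_product of_rat_divide sum_divide_distrib)
    also have "\<dots> = \<epsilon> * \<beta> (a j)"
      using \<epsilon>(2)[of j] m(1) by (simp add: p_def additive_nat_pow)
    finally show ?thesis .
  qed
  then show ?thesis
    using \<epsilon>(1) by blast
qed

end

end

section \<open>Reduction to spaces of points of type \<open>real\<close>\<close>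

lemma UN_lepoll_infinite:
  assumes "infinite B" "I \<lesssim> B" "\<And>i. i \<in> I \<Longrightarrow> F i \<lesssim> B"
  shows "(\<Union>i\<in>I. F i) \<lesssim> B"
  using card_of_UNION_ordLeq_infinite[of B I F] assms unfolding lepoll_def card_of_ordLeq by blast

text \<open>Close \<open>{x}\<close> under the group and under one chosen geodesic per ordered pair.
  Geodesics are images of real intervals, \<open>G\<close> is countable and so are the stages, so
  the cardinality stays within the continuum.\<close>

lemma geodesic_invariant_hull:
  fixes X :: "'x set"
  assumes geo: "geodesic_space X d" and act: "isometric_action G X d \<rho>"
    and G: "countable (carrier G)" and x: "x \<in> X"
  shows "\<exists>S\<subseteq>X. x \<in> S \<and> (\<forall>g\<in>carrier G. \<rho> g ` S \<subseteq> S) \<and> geodesic_space S d \<and>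
    S \<lesssim> (UNIV :: real set)"
proof -
  interpret M: Metric_space X d
    using geo by (simp add: geodesic_space_def)
  interpret act: group_action G X \<rho>
    using act by (simp add: isometric_action_def)
  interpret group G
    using act.group_hom group_hom.axioms(1) by auto
  have "\<forall>u\<in>X. \<forall>v\<in>X. \<exists>\<gamma>::real \<Rightarrow> 'x. \<gamma> ` {0..d u v} \<subseteq> X \<and> \<gamma> 0 = u \<and> \<gamma> (d u v) = v \<and>
      (\<forall>s\<in>{0..d u v}. \<forall>t\<in>{0..d u v}. d (\<gamma> s) (\<gamma> t) = \<bar>s - t\<bar>)"
    using geo by (simp add: geodesic_space_def)
  then obtain \<Gamma> where \<Gamma>: "\<forall>u\<in>X. \<forall>v\<in>X. \<Gamma> u v ` {0..d u v} \<subseteq> X \<and> \<Gamma> u v 0 = u \<and>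
      \<Gamma> u v (d u v) = v \<and> (\<forall>s\<in>{0..d u v}. \<forall>t\<in>{0..d u v}. d (\<Gamma> u v s) (\<Gamma> u v t) = \<bar>s - t\<bar>)"
    by metis
  have one: "\<rho> \<one>\<^bsub>G\<^esub> u = u" if "u \<in> X" for u
    using act.id_eq_one that by (metis restrict_apply')
  \<comment> \<open>As \<open>\<rho> \<one>\<close> is the identity and \<open>\<Gamma> u v 0 = u\<close>, one step adds both the translates of \<open>S\<close> and the
     geodesics between its points.\<close>
  define step where
    "step S = (\<Union>u\<in>S. \<Union>v\<in>S. \<Union>g\<in>carrier G. \<rho> g ` \<Gamma> u v ` {0..d u v})" for S
  have step_X: "step S \<subseteq> X" if "S \<subseteq> X" for S
    unfolding step_def using that \<Gamma> act.surj_prop by (intro UN_least) blast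
  have step_geo: "\<Gamma> u v ` {0..d u v} \<subseteq> step S" if S: "S \<subseteq> X" and "u \<in> S" "v \<in> S" for S u v
  proof -
    have "\<Gamma> u v ` {0..d u v} \<subseteq> X"
      using \<Gamma> that by blast
    then have "\<Gamma> u v ` {0..d u v} = \<rho> \<one>\<^bsub>G\<^esub> ` \<Gamma> u v ` {0..d u v}"
      using one by (force simp: image_iff)
    also have "\<dots> \<subseteq> step S"
      unfolding step_def using that one_closed by blast
    finally show ?thesis .
  qed
  have step_act: "\<rho> g ` S \<subseteq> step S" if S: "S \<subseteq> X" and g: "g \<in> carrier G" for S g
  proof
    fix w assume "w \<in> \<rho> g ` S"
    then obtain u where u: "u \<in> S" "w = \<rho> g u"
      by blast
    then have "u \<in> \<Gamma> u u ` {0..d u u}"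
      using \<Gamma> S by (auto intro!: image_eqI[of _ _ 0])
    then show "w \<in> step S"
      unfolding step_def using u g by blast
  qed
  define H where "H n = (step ^^ n) {x}" for n
  have H_Suc: "H (Suc n) = step (H n)" and H_0: "H 0 = {x}" for n
    by (simp_all add: H_def)
  have H_X: "H n \<subseteq> X" for n
    by (induction n) (simp_all add: H_Suc H_0 x step_X)
  have "H n \<subseteq> H (Suc n)" for n
    using step_act[OF H_X one_closed] one H_X[of n] by (force simp: H_Suc)
  then have mono: "H m \<subseteq> H n" if "m \<le> n" for m n
    using lift_Suc_mono_le[of H] that by blast
  have H_card: "H n \<lesssim> (UNIV :: real set)" for n
  proof (induction n)
    case 0
    show ?case
      by (simp add: H_0 finite_lepoll_infinite infinite_UNIV_char_0)
  next
    case (Suc n)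
    have "carrier G \<lesssim> (UNIV :: real set)"
    proof (rule lepoll_trans)
      show "carrier G \<lesssim> (UNIV :: nat set)"
        using G by (auto simp: countable_def lepoll_def)
      show "(UNIV :: nat set) \<lesssim> (UNIV :: real set)"
        using infinite_UNIV_char_0 infinite_le_lepoll by blast
    qed
    moreover have "\<rho> g ` \<Gamma> u v ` {0..d u v} \<lesssim> (UNIV :: real set)" for g u v
      by (meson image_lepoll lepoll_trans subset_UNIV subset_imp_lepoll)
    ultimately show ?case
      unfolding H_Suc step_def using Suc by (intro UN_lepoll_infinite infinite_UNIV_char_0)
  qed
  define S where "S = (\<Union>n. H n)"
  have SX: "S \<subseteq> X"
    using H_X by (auto simp: S_def)
  have "x \<in> S"
    using H_0 by (auto simp: S_def)
  moreover have "\<rho> g ` S \<subseteq> S" if "g \<in> carrier G" for g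
    using step_act[OF H_X that] by (auto simp: S_def H_Suc[symmetric] image_subset_iff)
  moreover have "geodesic_space S d"
    unfolding geodesic_space_def
  proof (intro conjI ballI)
    show "Metric_space S d"
      using SX by (rule M.subspace)
    fix u v assume uv: "u \<in> S" "v \<in> S"
    \<comment> \<open>The stages increase, so both points lie in stage \<open>max m n\<close> and
      their geodesic is added one stage later.\<close>
    then obtain m n where "u \<in> H m" "v \<in> H n"
      by (auto simp: S_def)
    then have "u \<in> H (max m n)" "v \<in> H (max m n)"
      using mono max.cobounded1 max.cobounded2 by blast+
    then have "\<Gamma> u v ` {0..d u v} \<subseteq> H (Suc (max m n))"
      unfolding H_Suc by (rule step_geo[OF H_X])
    then have "\<Gamma> u v ` {0..d u v} \<subseteq> S"
      by (auto simp: S_def)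
    then show "\<exists>\<gamma>. \<gamma> ` {0..d u v} \<subseteq> S \<and> \<gamma> 0 = u \<and> \<gamma> (d u v) = v \<and>
        (\<forall>s\<in>{0..d u v}. \<forall>t\<in>{0..d u v}. d (\<gamma> s) (\<gamma> t) = \<bar>s - t\<bar>)"
      using \<Gamma> SX uv by (intro exI[of _ "\<Gamma> u v"]) blast
  qed
  moreover have "S \<lesssim> (UNIV :: real set)"
    unfolding S_def using H_card infinite_UNIV_char_0
    by (intro UN_lepoll_infinite) (auto simp flip: infinite_le_lepoll)
  ultimately show ?thesis
    using SX by blast
qed

text \<open>The Gromov inequality passes to every subset, whereas geodesics do not, hence the
  separate assumption \<open>geo\<close>. The maps \<open>\<rho>' g\<close> are restricted because
  the elements of \<open>BijGroup\<close> are extensional.\<close>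

lemma isometric_action_transfer:
  fixes f :: "'x \<Rightarrow> 'y"
  assumes geo: "geodesic_space S d" and hyp: "hyperbolic_space X d" and SX: "S \<subseteq> X"
    and act: "isometric_action G X d \<rho>" and inv: "\<And>g. g \<in> carrier G \<Longrightarrow> \<rho> g ` S \<subseteq> S"
    and f: "inj_on f S"
  defines "h \<equiv> inv_into S f"
  defines "d' \<equiv> \<lambda>r s. d (h r) (h s)" and "\<rho>' \<equiv> \<lambda>g. \<lambda>r\<in>f ` S. f (\<rho> g (h r))"
  shows "hyperbolic_space (f ` S) d'" "isometric_action G (f ` S) d' \<rho>'"
proof -
  interpret M: Metric_space S d
    using geo by (simp add: geodesic_space_def)
  interpret act: group_action G X \<rho>
    using act by (simp add: isometric_action_def)
  interpret group G
    using act.group_hom group_hom.axioms(1) by auto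
  have hf: "h (f u) = u" if "u \<in> S" for u
    using that f by (simp add: h_def)
  have d'f: "d' (f u) (f v) = d u v" if "u \<in> S" "v \<in> S" for u v
    using that by (simp add: d'_def hf)
  have \<rho>'f: "\<rho>' g (f u) = f (\<rho> g u)" if "u \<in> S" for g u
    using that by (simp add: \<rho>'_def hf)
  have \<rho>S: "\<rho> g u \<in> S" if "g \<in> carrier G" "u \<in> S" for g u
    using inv that by blast
  show "hyperbolic_space (f ` S) d'"
    unfolding hyperbolic_space_def geodesic_space_def
  proof (intro conjI ballI)
    show "Metric_space (f ` S) d'"
    proof
      \<comment> \<open>\<open>Metric_space\<close> demands these two laws on the whole type, not
        only on its point set.\<close>
      show "\<And>r s. 0 \<le> d' r s" "\<And>r s. d' r s = d' s r"
        by (simp_all add: d'_def M.commute)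
      show "d' r s = 0 \<longleftrightarrow> r = s" if "r \<in> f ` S" "s \<in> f ` S" for r s
        using that f by (auto simp: d'f inj_on_eq_iff)
      show "d' r t \<le> d' r s + d' s t" if "r \<in> f ` S" "s \<in> f ` S" "t \<in> f ` S" for r s t
        using that by (auto simp: d'f M.triangle)
    qed
    fix r s assume "r \<in> f ` S" "s \<in> f ` S"
    then obtain u v where uv: "u \<in> S" "v \<in> S" "r = f u" "s = f v"
      by blast
    have "\<exists>\<gamma>::real \<Rightarrow> 'x. \<gamma> ` {0..d u v} \<subseteq> S \<and> \<gamma> 0 = u \<and> \<gamma> (d u v) = v \<and>
        (\<forall>s\<in>{0..d u v}. \<forall>t\<in>{0..d u v}. d (\<gamma> s) (\<gamma> t) = \<bar>s - t\<bar>)"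
      using geo uv(1,2) by (simp add: geodesic_space_def)
    then obtain \<gamma> :: "real \<Rightarrow> 'x" where \<gamma>: "\<gamma> ` {0..d u v} \<subseteq> S" "\<gamma> 0 = u" "\<gamma> (d u v) = v"
        "\<forall>s\<in>{0..d u v}. \<forall>t\<in>{0..d u v}. d (\<gamma> s) (\<gamma> t) = \<bar>s - t\<bar>"
      by blast
    have "d' (f (\<gamma> s)) (f (\<gamma> t)) = \<bar>s - t\<bar>" if "s \<in> {0..d u v}" "t \<in> {0..d u v}" for s t
    proof -
      have "\<gamma> s \<in> S" "\<gamma> t \<in> S"
        using \<gamma>(1) that by blast+
      then show ?thesis
        using \<gamma>(4) that by (simp add: d'f)
    qed
    moreover have "(f \<circ> \<gamma>) ` {0..d u v} \<subseteq> f ` S"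
      using \<gamma>(1) by auto
    ultimately show "\<exists>\<gamma>. \<gamma> ` {0..d' r s} \<subseteq> f ` S \<and> \<gamma> 0 = r \<and> \<gamma> (d' r s) = s \<and>
        (\<forall>p\<in>{0..d' r s}. \<forall>q\<in>{0..d' r s}. d' (\<gamma> p) (\<gamma> q) = \<bar>p - q\<bar>)"
      using \<gamma> uv by (intro exI[of _ "f \<circ> \<gamma>"]) (simp add: d'f)
  next
    obtain \<delta> where \<delta>: "\<delta> \<ge> 0" "\<forall>w\<in>X. \<forall>x\<in>X. \<forall>y\<in>X. \<forall>z\<in>X.
        gromov_product d w x z \<ge> min (gromov_product d w x y) (gromov_product d w y z) - \<delta>"
      using hyp unfolding hyperbolic_space_def by blast
    have prod: "gromov_product d' w x y = gromov_product d (h w) (h x) (h y)" for w x y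
      by (simp add: gromov_product_def d'_def)
    have hX: "h r \<in> X" if "r \<in> f ` S" for r
      using inv_into_into[OF that] SX by (auto simp: h_def)
    show "\<exists>\<delta>\<ge>0. \<forall>w\<in>f ` S. \<forall>x\<in>f ` S. \<forall>y\<in>f ` S. \<forall>z\<in>f ` S.
        gromov_product d' w x z \<ge> min (gromov_product d' w x y) (gromov_product d' w y z) - \<delta>"
      unfolding prod using \<delta> hX by blast
  qed
  have comp: "\<rho>' (g \<otimes>\<^bsub>G\<^esub> k) r = \<rho>' g (\<rho>' k r)" if "g \<in> carrier G" "k \<in> carrier G" "r \<in> f ` S" for g k r
    using that SX \<rho>S by (auto simp: \<rho>'f act.composition_rule subset_iff)
  have one: "\<rho>' \<one>\<^bsub>G\<^esub> r = r" if r: "r \<in> f ` S" for r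
  proof -
    obtain u where "u \<in> S" "r = f u"
      using r by blast
    moreover from this have "\<rho> \<one>\<^bsub>G\<^esub> u = u"
      using act.id_eq_one SX by (metis restrict_apply' subsetD)
    ultimately show ?thesis
      by (simp add: \<rho>'f)
  qed
  have im: "\<rho>' g r \<in> f ` S" if "g \<in> carrier G" "r \<in> f ` S" for g r
    using that \<rho>S by (auto simp: \<rho>'f)
  have bij: "\<rho>' g \<in> Bij (f ` S)" if g: "g \<in> carrier G" for g
  proof -
    have "\<rho>' g (\<rho>' (inv\<^bsub>G\<^esub> g) r) = r" "\<rho>' (inv\<^bsub>G\<^esub> g) (\<rho>' g r) = r" if "r \<in> f ` S" for r
      using comp[of g "inv\<^bsub>G\<^esub> g" r] comp[of "inv\<^bsub>G\<^esub> g" g r] one[OF that] g that by simp_all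
    then have "bij_betw (\<rho>' g) (f ` S) (f ` S)"
      using im g by (intro bij_betwI[of _ _ _ "\<rho>' (inv\<^bsub>G\<^esub> g)"]) auto
    then show ?thesis
      by (simp add: Bij_def \<rho>'_def)
  qed
  have "\<rho>' \<in> hom G (BijGroup (f ` S))"
  proof (rule homI)
    fix g k assume gk: "g \<in> carrier G" "k \<in> carrier G"
    show "\<rho>' (g \<otimes>\<^bsub>G\<^esub> k) = \<rho>' g \<otimes>\<^bsub>BijGroup (f ` S)\<^esub> \<rho>' k"
    proof
      fix r
      show "\<rho>' (g \<otimes>\<^bsub>G\<^esub> k) r = (\<rho>' g \<otimes>\<^bsub>BijGroup (f ` S)\<^esub> \<rho>' k) r"
      proof (cases "r \<in> f ` S")
        case True
        then show ?thesis
          using comp gk bij by (simp add: BijGroup_def compose_def)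
      next
        case False
        \<comment> \<open>Outside the image of \<open>S\<close> both sides are
          \<open>undefined\<close>.\<close>
        then show ?thesis
          using gk bij by (simp add: BijGroup_def compose_def) (simp add: \<rho>'_def)
      qed
    qed
  qed (simp add: BijGroup_def bij)
  then have "group_action G (f ` S) \<rho>'"
    by (simp add: group_action_def group_hom_def group_hom_axioms_def group_BijGroup)
  moreover have "d (\<rho> g u) (\<rho> g v) = d u v" if "g \<in> carrier G" "u \<in> S" "v \<in> S" for g u v
    using act SX that by (auto simp: isometric_action_def)
  then have "\<forall>g\<in>carrier G. \<forall>r\<in>f ` S. \<forall>s\<in>f ` S. d' (\<rho>' g r) (\<rho>' g s) = d' r s"
    using \<rho>S by (auto simp: \<rho>'f d'f)
  ultimately show "isometric_action G (f ` S) d' \<rho>'"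
    by (simp add: isometric_action_def)
qed

text \<open>The hull is grown from the point \<open>x\<close> that witnesses loxodromy, so it
  contains the orbit of \<open>x\<close>; its copy in the reals has the same displacements and the
  same constant \<open>c\<close>.\<close>

lemma never_loxodromic_real_imp:
  assumes G: "countable (carrier G)" "group G" and z: "z \<in> carrier G"
    and real: "never_loxodromic TYPE(real) G z"
  shows "never_loxodromic TYPE('x) G z"
  unfolding never_loxodromic_def
proof (intro allI impI notI)
  fix X :: "'x set" and d \<rho>
  assume hyp: "hyperbolic_space X d" and act: "isometric_action G X d \<rho>"
    and "acts_loxodromically G X d \<rho> z"
  then obtain x c where x: "x \<in> X" and c: "c > 0"
    and lox: "\<And>k::int. d (\<rho> (z [^]\<^bsub>G\<^esub> k) x) x \<ge> of_int \<bar>k\<bar> * c"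
    by (auto simp: acts_loxodromically_def)
  have "geodesic_space X d"
    using hyp by (simp add: hyperbolic_space_def)
  from geodesic_invariant_hull[OF this act G(1) x] obtain S where S: "S \<subseteq> X" "x \<in> S"
      "\<And>g. g \<in> carrier G \<Longrightarrow> \<rho> g ` S \<subseteq> S" "geodesic_space S d" "S \<lesssim> (UNIV :: real set)"
    by blast
  then obtain f :: "'x \<Rightarrow> real" where f: "inj_on f S"
    by (auto simp: lepoll_def)
  let ?h = "inv_into S f"
  let ?d = "\<lambda>r s. d (?h r) (?h s)" and ?\<rho> = "\<lambda>g. \<lambda>r\<in>f ` S. f (\<rho> g (?h r))"
  have "?d (?\<rho> (z [^]\<^bsub>G\<^esub> k) (f x)) (f x) = d (\<rho> (z [^]\<^bsub>G\<^esub> k) x) x" for k :: int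
  proof -
    have "\<rho> (z [^]\<^bsub>G\<^esub> k) x \<in> S"
      using S(2,3) group.int_pow_closed[OF G(2) z] by blast
    then show ?thesis
      using S(2) f by simp
  qed
  then have "acts_loxodromically G (f ` S) ?d ?\<rho> z"
    unfolding acts_loxodromically_def using S(2) c lox by (intro bexI[of _ "f x"] exI[of _ c]) auto
  then show False
    using real isometric_action_transfer[OF S(4) hyp S(1) act S(3) f]
    by (auto simp: never_loxodromic_def)
qed

section \<open>Generalised Baumslag-Solitar groups\<close>

text \<open>\<open>G\<close> is a quotient of a set of words over a countable alphabet: the graph is
  finite and its vertex groups are countable.\<close>

lemma countable_GBS:
  assumes "GBS N G Y T \<phi>"
  shows "countable (carrier G)"
proof -
  have "countable (carrier (vgrp Y v))" if v: "v \<in> verts Y" for v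
  proof -
    obtain h where "h \<in> iso (vgrp Y v) (Zn N)"
      using assms v by (auto simp: GBS_def is_iso_def)
    then have "inj_on h (carrier (vgrp Y v))"
      by (simp add: iso_def bij_betw_def)
    then show ?thesis
      \<comment> \<open>The image lies in \<open>'n \<Rightarrow> int\<close>, a countable type
        since \<open>'n\<close> is finite.\<close>
      by (rule countable_image_inj_on[OF countableI_type])
  qed
  moreover have "countable (verts Y)" "countable (edges Y)"
    using assms by (auto simp: GBS_def countable_finite)
  ultimately have "countable ((\<Union>v\<in>verts Y. Vtx v ` carrier (vgrp Y v)) \<union> Edg ` edges Y)"
    by (intro countable_Un countable_UN countable_image)
  moreover have "gog_words Y = lists ((\<Union>v\<in>verts Y. Vtx v ` carrier (vgrp Y v)) \<union> Edg ` edges Y)"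
    unfolding gog_words_def by (rule arg_cong[where f = lists]) auto
  ultimately have "countable (gog_words Y)"
    by (simp only: countable_lists)
  then have "countable (\<phi> ` carrier (fundamental_group Y T))"
    by (simp add: fundamental_group_def)
  moreover have "\<phi> ` carrier (fundamental_group Y T) = carrier G"
    using assms by (auto simp: GBS_def iso_def bij_betw_def)
  ultimately show ?thesis
    by simp
qed

lemma comm_group_Zn: "comm_group (Zn N)"
proof (rule group.group_comm_groupI)
  show "group (Zn N)"
    by (simp add: Zn_def)
qed (simp add: Zn_def add.commute)

text \<open>The exponents \<open>k\<close> come from the monodromy alone, before any space is fixed,
  so one \<open>z\<close> serves all actions on spaces with points in \<open>'x\<close>.\<close>

lemma exists_never_loxodromic:
  fixes G :: "'g monoid" and a :: "'n::finite \<Rightarrow> 'g"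
  assumes G: "group G" and A: "subgroup A G" "comm_group (G\<lparr>carrier := A\<rparr>)"
    and basis: "Z_basis G A a" and inf: "infinite (monodromy G A a)"
  shows "\<exists>z\<in>A. z \<noteq> \<one>\<^bsub>G\<^esub> \<and> never_loxodromic TYPE('x) G z"
proof -
  note ctx = G A basis
  obtain k :: "'n \<Rightarrow> int" where k: "k \<noteq> (\<lambda>_. 0)"
    and orth: "\<And>b :: 'n \<Rightarrow> real.
      (\<And>g M. g \<in> carrier G \<Longrightarrow> modular_matrix G A a g M \<Longrightarrow>
         \<exists>\<epsilon>\<in>{1, -1}. \<forall>j. (\<Sum>i\<in>UNIV. b i * of_rat (M $ i $ j)) = \<epsilon> * b j) \<Longrightarrow>
      (\<Sum>i\<in>UNIV. b i * of_int (k i)) = 0"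
    using infinite_rat_matrices_imp_orthogonal_int_vector[OF infinite_modular_matrices[OF ctx inf]]
    by blast
  define z where "z = power_product G A a k"
  have zA: "z \<in> A"
    unfolding z_def by (rule power_product_closed[OF ctx])
  moreover have "z \<noteq> \<one>\<^bsub>G\<^esub>"
    using power_product_inject[OF ctx] power_product_zero[OF ctx] k unfolding z_def by metis
  moreover have "never_loxodromic TYPE('x) G z"
    unfolding never_loxodromic_def
  proof (intro allI impI notI)
    fix X :: "'x set" and d \<rho>
    assume hyp: "hyperbolic_space X d" and act: "isometric_action G X d \<rho>"
      and "acts_loxodromically G X d \<rho> z"
    then obtain x c where x: "x \<in> X" and c: "c > 0"
      and lox: "\<And>k::int. d (\<rho> (z [^]\<^bsub>G\<^esub> k) x) x \<ge> of_int \<bar>k\<bar> * c"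
      by (auto simp: acts_loxodromically_def)
    obtain C where "hyperbolic_length G (\<lambda>g. d (\<rho> g x) x) C"
      using hyperbolic_length_displacement[OF hyp act x] by blast
    then interpret L: hyperbolic_length G "\<lambda>g. d (\<rho> g x) x" C .
    have AG: "y \<in> carrier G" if "y \<in> A" for y
      using subgroup.mem_carrier[OF A(1) that] .
    have pos: "L.stable_len z > 0"
    proof (rule L.stable_len_pos[OF AG[OF zA] c])
      show "real n * c \<le> d (\<rho> (z [^]\<^bsub>G\<^esub> n) x) x" for n :: nat
        using lox[of "int n"] by (simp add: int_pow_int)
    qed
    \<comment> \<open>The supposed loxodromy of \<open>z\<close> is what makes
      \<open>\<beta>\<close> available, through \<open>pos\<close>.\<close>
    obtain \<beta> where add: "\<And>u v. u \<in> A \<Longrightarrow> v \<in> A \<Longrightarrow> \<beta> (u \<otimes>\<^bsub>G\<^esub> v) = \<beta> u + \<beta> v"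
      and abs: "\<And>u. u \<in> A \<Longrightarrow> \<bar>\<beta> u\<bar> = L.stable_len u"
      using L.stable_len_eq_abs_additive[OF A zA pos] by blast
    \<comment> \<open>Conjugation invariance of the stable length gives the sign condition of
      \<open>orth\<close> for the values of \<open>\<beta>\<close> on the basis.\<close>
    have "(\<Sum>i\<in>UNIV. \<beta> (a i) * of_int (k i)) = 0"
    proof (rule orth)
      fix g M
      assume g: "g \<in> carrier G" and M: "modular_matrix G A a g M"
      show "\<exists>\<epsilon>\<in>{1, -1}. \<forall>j. (\<Sum>i\<in>UNIV. \<beta> (a i) * of_rat (M $ i $ j)) = \<epsilon> * \<beta> (a j)"
        by (rule modular_matrix_eigenvector[OF ctx add g M])
          (simp_all add: abs AG L.stable_len_conj[OF g])
    qed
    then have "\<beta> z = 0"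
      unfolding z_def using additive_power_product[OF ctx, of \<beta>] add by simp
    then show False
      using abs[OF zA] pos by simp
  qed
  ultimately show ?thesis
    by blast
qed

theorem theorem3p5:
  fixes G :: "'g monoid"
    and Y :: "('v, 'e, 'a, 'b) graph_of_groups"
    and T :: "'e set"
    and \<phi> :: "('v, 'e, 'a) letter list set \<Rightarrow> 'g"
    and A :: "'g set"
    and a :: "'n::finite \<Rightarrow> 'g"
  assumes "GBS TYPE('n) G Y T \<phi>"
    and "base_Zn_subgroup TYPE('n) G Y T \<phi> A"
    and "Z_basis G A a"
    and "infinite (monodromy G A a)"
  shows "(\<exists>z\<in>A. z \<noteq> \<one>\<^bsub>G\<^esub> \<and> never_loxodromic TYPE(real) G z) \<and>
         (\<forall>z\<in>A. never_loxodromic TYPE(real) G z \<longrightarrow> never_loxodromic TYPE('x) G z)"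
proof -
  have G: "group G"
    using assms(1) by (simp add: GBS_def)
  have A: "subgroup A G" and iso: "G\<lparr>carrier := A\<rparr> \<cong> Zn TYPE('n)"
    using assms(2) by (auto simp: base_Zn_subgroup_def finite_index_in_def)
  have H: "group (G\<lparr>carrier := A\<rparr>)"
    by (rule subgroup.subgroup_is_group[OF A G])
  \<comment> \<open>Commutativity is carried over from the model group along the inverse
    isomorphism.\<close>
  then have "comm_group (G\<lparr>carrier := A\<rparr>)"
    using comm_group.iso_imp_comm_group[OF comm_group_Zn group.iso_sym[OF H iso]] group.is_monoid
    by blast
  then have "\<exists>z\<in>A. z \<noteq> \<one>\<^bsub>G\<^esub> \<and> never_loxodromic TYPE(real) G z"
    by (rule exists_never_loxodromic[OF G A _ assms(3,4)])
  \<comment> \<open>Countability of \<open>G\<close> gives the passage from real points to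
    \<open>'x\<close> for every \<open>z\<close> in \<open>A\<close>.\<close>
  moreover have "never_loxodromic TYPE('x) G z" if "z \<in> A" "never_loxodromic TYPE(real) G z" for z
    using never_loxodromic_real_imp[OF countable_GBS[OF assms(1)] G _ that(2)]
      subgroup.mem_carrier[OF A that(1)] by blast
  ultimately show ?thesis
    by blast
qed

end
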